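(* Suppose $X \in \mathcal{B}^{N,M}$ and $W \in \mathcal{B}^{N,R}$ are Boolean matrices with $\mathrm{cone}(X) \subset \mathrm{cone}(W)$. Let $x_1,\dots,x_M \in \mathcal{B}^N$ denote the columns of $X$. Then $X = W \land H$ has a unique $H \in \mathcal{B}^{R,M}$ for the fixed $W$ if and only if the collections $P(x_i, W)$ are free for each column $x_i$, $i \in \{1,\dots,M\}$.
   Context: $\mathcal{B} = \{0,1\}$ is the Boolean semiring with addition $\lor$ (logical or) and multiplication $\land$ (logical and). $W \land H$ denotes the Boolean matrix product, $(W\land H)_{i,j} = \bigvee_k (W_{i,k} \land H_{k,j})$. For a Boolean matrix $W \in \mathcal{B}^{N,R}$, $\mathrm{cone}(W) = \{W \land h : h \in \mathcal{B}^R\} \subset \mathcal{B}^N$. For $x,y \in \mathcal{B}^N$, say $x$ is dominated by $y$, written $x \le y$, if for each $i$ with $x_i = 1$ one has $y_i = 1$. For $x \in \mathcal{B}^N$ and $W\in\mathcal{B}^{N,R}$ with columns $w_1,\dots,w_R$, set $P(x,W) := \{w_i : w_i \le x\}$, the collection of columns of $W$ dominated by $x$, indexed by those $i \in \{1,\dots,R\}$ with $w_i \le x$. A collection of Boolean vectors $\{v_i\}_{i\in J} \subset \mathcal{B}^N$ with finite index set $J$ is free if, given any two non-empty subsets $I_1, I_2 \subset J$ with $I_1 \ne I_2$, one has $\bigvee_{i\in I_1} v_i \ne \bigvee_{i \in I_2} v_i$, where $\bigvee$ is the entrywise logical or.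
   Formalization: The case where X = 0 and W has exactly one zero column is excluded: there every P(x_i, W) is free, since only non-empty subsets are compared, yet H is not unique (e.g. X = W = [0] with H = [0] or [1]), so the claim is false as stated. *)

theory Defs
  imports "HOL-Analysis.Analysis"
begin

text \<open>
  A Boolean \<open>N \<times> R\<close> matrix is a \<open>bool ^ 'r ^ 'n\<close> with \<open>CARD('n) = N\<close> and \<open>CARD('r) = R\<close>;
  \<open>False\<close>, \<open>True\<close>, \<open>\<or>\<close>, \<open>\<and>\<close> stand for \<open>0\<close>, \<open>1\<close>, addition and multiplication.
\<close>

definition bool_mat_mult :: "bool ^ 'r ^ 'n \<Rightarrow> bool ^ 'm ^ 'r \<Rightarrow> bool ^ 'm ^ 'n"
    (infixl \<open>\<otimes>\<^sub>B\<close> 70)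
  where "W \<otimes>\<^sub>B H = (\<chi> i j. \<exists>k. W $ i $ k \<and> H $ k $ j)"

definition bool_mat_vec :: "bool ^ 'r ^ 'n \<Rightarrow> bool ^ 'r \<Rightarrow> bool ^ 'n"
    (infixl \<open>\<otimes>\<^sub>v\<close> 70)
  where "W \<otimes>\<^sub>v h = (\<chi> i. \<exists>k. W $ i $ k \<and> h $ k)"

definition bool_cone :: "bool ^ 'r ^ 'n \<Rightarrow> (bool ^ 'n) set"
  where "bool_cone W = {W \<otimes>\<^sub>v h |h. True}"

definition bool_join :: "'j set \<Rightarrow> ('j \<Rightarrow> bool ^ 'n) \<Rightarrow> bool ^ 'n"
  where "bool_join I v = (\<chi> i. \<exists>j\<in>I. v j $ i)"

definition bool_free :: "'j set \<Rightarrow> ('j \<Rightarrow> bool ^ 'n) \<Rightarrow> bool"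
  where "bool_free J v \<longleftrightarrow>
    (\<forall>I\<^sub>1 I\<^sub>2. I\<^sub>1 \<subseteq> J \<and> I\<^sub>2 \<subseteq> J \<and> I\<^sub>1 \<noteq> {} \<and> I\<^sub>2 \<noteq> {} \<and> I\<^sub>1 \<noteq> I\<^sub>2 \<longrightarrow>
       bool_join I\<^sub>1 v \<noteq> bool_join I\<^sub>2 v)"

text \<open>
  The index set of the collection \<open>P(x, W)\<close>; the collection itself is the family
  \<open>\<lambda>k. column k W\<close> on it, so equal columns with different indices count separately.
  On \<open>bool ^ 'n\<close> the order \<open>\<le>\<close> is entrywise implication.
\<close>

definition dominated_cols :: "bool ^ 'n \<Rightarrow> bool ^ 'r ^ 'n \<Rightarrow> 'r set"
  where "dominated_cols x W = {k. column k W \<le> x}"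

text \<open>
  Freeness compares non-empty index sets only, so a single zero vector is free although it has
  the same join as the empty set. Hence the equivalence of uniqueness and freeness fails when
  \<open>X = 0\<close> and exactly one column of \<open>W\<close> is zero.
\<close>

lemma zero_matrix_free_not_unique:
  fixes X :: "bool ^ 'm ^ 'n" and W :: "bool ^ 'r ^ 'n"
  assumes X: "\<forall>i j. \<not> X $ i $ j" and W: "\<exists>!k. \<forall>i. \<not> W $ i $ k"
  shows "bool_cone X \<subseteq> bool_cone W"
    and "\<forall>j. bool_free (dominated_cols (column j X) W) (\<lambda>k. column k W)"
    and "\<not> (\<exists>!H. X = W \<otimes>\<^sub>B H)"
proof -
  obtain k where k: "\<And>i. \<not> W $ i $ k" and k': "\<And>l. \<forall>i. \<not> W $ i $ l \<Longrightarrow> l = k"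
    using W by blast
  show "bool_cone X \<subseteq> bool_cone W"
  proof
    fix x assume "x \<in> bool_cone X"
    then have "x = W \<otimes>\<^sub>v (\<chi> k. False)"
      using X by (auto simp: bool_cone_def bool_mat_vec_def vec_eq_iff)
    then show "x \<in> bool_cone W" unfolding bool_cone_def by blast
  qed
  have "dominated_cols (column j X) W \<subseteq> {k}" for j
    using X k' by (auto simp: dominated_cols_def less_eq_vec_def column_def)
  then show "\<forall>j. bool_free (dominated_cols (column j X) W) (\<lambda>k. column k W)"
    unfolding bool_free_def by (metis subset_singletonD subset_trans)
  have "X = W \<otimes>\<^sub>B (\<chi> l j. False)" "X = W \<otimes>\<^sub>B (\<chi> l j. l = k)"
    using X k by (auto simp: bool_mat_mult_def vec_eq_iff)
  moreover have "(\<chi> l j. False) \<noteq> ((\<chi> l j. l = k) :: bool ^ 'm ^ 'r)"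
    by (auto simp: vec_eq_iff)
  ultimately show "\<not> (\<exists>!H. X = W \<otimes>\<^sub>B H)" by blast
qed

end

theory Submission
  imports Defs
begin

text \<open>
  Uniqueness of \<open>H\<close> decouples over the columns: the support of the \<open>j\<close>-th column of \<open>H\<close> is a set of
  columns of \<open>W\<close> with join \<open>x\<^sub>j\<close>, necessarily a subset of \<open>P(x\<^sub>j, W)\<close>. Two distinct non-empty such
  sets contradict freeness. Conversely, if distinct sets \<open>I\<^sub>1\<close>, \<open>I\<^sub>2\<close> have equal joins and
  \<open>k \<in> I\<^sub>1 - I\<^sub>2\<close>, then \<open>w\<^sub>k\<close> is redundant in \<open>P(x\<^sub>j, W)\<close>, so \<open>x\<^sub>j\<close> is the join both of all of
  \<open>P(x\<^sub>j, W)\<close> and of \<open>P(x\<^sub>j, W) - {k}\<close>. The empty set, which freeness ignores, only matters when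
  \<open>x\<^sub>j = 0\<close> and \<open>W\<close> has a zero column; that column is then redundant for any non-zero \<open>x\<^sub>i\<close>.
\<close>

lemma bool_join_nth [simp]: "bool_join I v $ i \<longleftrightarrow> (\<exists>k\<in>I. v k $ i)"
  by (simp add: bool_join_def)

lemma bool_join_le_iff: "bool_join I v \<le> x \<longleftrightarrow> (\<forall>k\<in>I. v k \<le> x)"
  by (auto simp: less_eq_vec_def)

lemma bool_join_mono: "I \<subseteq> J \<Longrightarrow> bool_join I v \<le> bool_join J v"
  by (auto simp: less_eq_vec_def)

lemma bool_mat_mult_eq_iff:
  "X = W \<otimes>\<^sub>B H \<longleftrightarrow> (\<forall>j. bool_join {k. H $ k $ j} (\<lambda>k. column k W) = column j X)"
  by (auto simp: bool_mat_mult_def vec_eq_iff column_def)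

lemma bool_cone_eq: "bool_cone W = range (\<lambda>I. bool_join I (\<lambda>k. column k W))"
proof
  show "bool_cone W \<subseteq> range (\<lambda>I. bool_join I (\<lambda>k. column k W))"
  proof
    fix x assume "x \<in> bool_cone W"
    then obtain h where "x = W \<otimes>\<^sub>v h" by (auto simp: bool_cone_def)
    then have "x = bool_join {k. h $ k} (\<lambda>k. column k W)"
      by (auto simp: bool_mat_vec_def vec_eq_iff column_def)
    then show "x \<in> range (\<lambda>I. bool_join I (\<lambda>k. column k W))" by blast
  qed
  show "range (\<lambda>I. bool_join I (\<lambda>k. column k W)) \<subseteq> bool_cone W"
  proof clarify
    fix I
    have "bool_join I (\<lambda>k. column k W) = W \<otimes>\<^sub>v (\<chi> k. k \<in> I)"
      by (auto simp: bool_mat_vec_def vec_eq_iff column_def)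
    then show "bool_join I (\<lambda>k. column k W) \<in> bool_cone W"
      unfolding bool_cone_def by blast
  qed
qed

lemma column_in_bool_cone: "column j X \<in> bool_cone X"
proof -
  have "column j X = bool_join {j} (\<lambda>k. column k X)"
    by (simp add: vec_eq_iff)
  then show ?thesis unfolding bool_cone_eq by blast
qed

lemma ex1_factor_iff:
  fixes X :: "bool ^ 'm ^ 'n" and W :: "bool ^ 'r ^ 'n"
  shows "(\<exists>!H. X = W \<otimes>\<^sub>B H) \<longleftrightarrow> (\<forall>j. \<exists>!I. bool_join I (\<lambda>k. column k W) = column j X)"
    (is "?L \<longleftrightarrow> ?R")
proof
  assume ?L
  then obtain H where H: "X = W \<otimes>\<^sub>B H" and uniq: "\<And>H'. X = W \<otimes>\<^sub>B H' \<Longrightarrow> H' = H"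
    by blast
  show ?R
  proof (intro allI ex1I)
    fix j
    show "bool_join {k. H $ k $ j} (\<lambda>k. column k W) = column j X"
      using H by (simp add: bool_mat_mult_eq_iff)
    fix I assume I: "bool_join I (\<lambda>k. column k W) = column j X"
    \<comment> \<open>The columns of a factor can be chosen independently: overwriting column
      \<open>j\<close> of \<open>H\<close> by the indicator of \<open>I\<close> gives another factor
      of \<open>X\<close>.\<close>
    let ?H' = "\<chi> k l. if l = j then k \<in> I else H $ k $ l"
    have "bool_join {k. ?H' $ k $ l} (\<lambda>k. column k W) = column l X" for l
      using H I by (cases "l = j") (simp_all add: bool_mat_mult_eq_iff)
    then have "X = W \<otimes>\<^sub>B ?H'"
      unfolding bool_mat_mult_eq_iff by blast
    then have "?H' = H" by (rule uniq)
    then have "?H' $ k $ j = H $ k $ j" for k by simp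
    then show "I = {k. H $ k $ j}" by auto
  qed
next
  assume R: ?R
  then obtain S where S: "\<And>j. bool_join (S j) (\<lambda>k. column k W) = column j X"
    by metis
  show ?L
  proof (rule ex1I)
    show "X = W \<otimes>\<^sub>B (\<chi> k j. k \<in> S j)"
      using S by (simp add: bool_mat_mult_eq_iff)
    fix H assume "X = W \<otimes>\<^sub>B H"
    then have "{k. H $ k $ j} = S j" for j
      using R S unfolding bool_mat_mult_eq_iff by metis
    then show "H = (\<chi> k j. k \<in> S j)" by (auto simp: vec_eq_iff)
  qed
qed

lemma bool_free_if_unique_join:
  assumes "\<exists>!I. bool_join I v = x"
  shows "bool_free {k. v k \<le> x} v"
proof -
  let ?J = "{k. v k \<le> x}"
  obtain I where I: "bool_join I v = x" using assms by blast
  then have "I \<subseteq> ?J" using bool_join_le_iff[of I v x] by auto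
  \<comment> \<open>\<open>?J\<close> is the largest index set whose join stays below
    \<open>x\<close>; it contains \<open>I\<close>, so its join reaches \<open>x\<close>.\<close>
  then have J: "bool_join ?J v = x"
    using I bool_join_mono[of I ?J v] by (intro antisym) (auto simp: bool_join_le_iff)
  \<comment> \<open>Only \<open>B\<close> has to lie in \<open>?J\<close>, so swapping
    \<open>A\<close> and \<open>B\<close> later gives the reverse inclusion.\<close>
  have sub: "A \<subseteq> B" if "B \<subseteq> ?J" and eq: "bool_join A v = bool_join B v" for A B
  proof
    fix k assume "k \<in> A"
    show "k \<in> B"
    proof (rule ccontr)
      assume "k \<notin> B"
      have "v k \<le> bool_join A v" using \<open>k \<in> A\<close> by (auto simp: less_eq_vec_def)
      also have "\<dots> = bool_join B v" by (rule eq)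
      \<comment> \<open>\<open>B\<close> avoids \<open>k\<close>, so the vectors other than
        \<open>v k\<close> already cover it.\<close>
      also have "\<dots> \<le> bool_join (?J - {k}) v"
        using \<open>k \<notin> B\<close> that(1) by (intro bool_join_mono) auto
      finally have vk: "v k \<le> bool_join (?J - {k}) v" .
      have "v l \<le> bool_join (?J - {k}) v" if "l \<in> ?J" for l
        using vk that by (cases "l = k") (auto simp: less_eq_vec_def)
      then have "bool_join ?J v \<le> bool_join (?J - {k}) v"
        by (simp add: bool_join_le_iff)
      then have "bool_join (?J - {k}) v = x"
        using J bool_join_mono[of "?J - {k}" ?J v] by auto
      then have "?J - {k} = ?J" using J assms by metis
      moreover have "k \<in> ?J"
        using \<open>v k \<le> bool_join A v\<close> eq that(1) bool_join_le_iff[of B v x] order_trans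
        by fastforce
      ultimately show False by blast
    qed
  qed
  then show ?thesis unfolding bool_free_def by (metis subset_antisym)
qed

text \<open>Index sets with join \<open>x\<close> consist of vectors below \<open>x\<close>, so
  freeness applies to them without a separate inclusion hypothesis.\<close>

lemma bool_freeD:
  assumes "bool_free {k. v k \<le> x} v" "bool_join A v = x" "bool_join B v = x"
    and "A \<noteq> {}" "B \<noteq> {}"
  shows "A = B"
proof -
  have "A \<subseteq> {k. v k \<le> x}" "B \<subseteq> {k. v k \<le> x}"
    using bool_join_le_iff[of A v x] bool_join_le_iff[of B v x] assms(2,3) by auto
  then show ?thesis using assms unfolding bool_free_def by metis
qed

text \<open>A zero vector can be added to \<open>I\<close> or removed from it without changing the
  join. Since \<open>x\<close> is non-zero, the set without it is still non-empty, so freeness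
  forbids this.\<close>

lemma no_zero_vector_if_free:
  assumes free: "bool_free {k. v k \<le> x} v" and I: "bool_join I v = x" and x: "x $ i"
  shows "\<exists>i. v k $ i"
proof (rule ccontr)
  assume "\<nexists>i. v k $ i"
  then have k: "\<not> v k $ i" for i by blast
  have "bool_join (insert k I) v = x" "bool_join (I - {k}) v = x"
    using k I by (auto simp: vec_eq_iff)
  moreover have "I - {k} \<noteq> {}" using x calculation(2) by auto
  ultimately have "insert k I = I - {k}" using bool_freeD[OF free] by blast
  then show False by blast
qed

theorem theorem3:
  fixes X :: "bool ^ 'm ^ 'n" and W :: "bool ^ 'r ^ 'n"
  assumes cone: "bool_cone X \<subseteq> bool_cone W"
    and nondegenerate: "\<not> ((\<forall>i j. \<not> X $ i $ j) \<and> (\<exists>!k. \<forall>i. \<not> W $ i $ k))"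
  shows "(\<exists>!H :: bool ^ 'm ^ 'r. X = W \<otimes>\<^sub>B H) \<longleftrightarrow>
         (\<forall>j. bool_free (dominated_cols (column j X) W) (\<lambda>k. column k W))"
proof
  assume "\<exists>!H :: bool ^ 'm ^ 'r. X = W \<otimes>\<^sub>B H"
  then show "\<forall>j. bool_free (dominated_cols (column j X) W) (\<lambda>k. column k W)"
    unfolding ex1_factor_iff dominated_cols_def using bool_free_if_unique_join by blast
next
  let ?w = "\<lambda>k. column k W"
  assume "\<forall>j. bool_free (dominated_cols (column j X) W) ?w"
  then have free: "bool_free {k. ?w k \<le> column j X} ?w" for j
    by (simp add: dominated_cols_def)
  have ex: "\<exists>I. bool_join I ?w = column j X" for j
    using cone column_in_bool_cone[of j X] unfolding bool_cone_eq[of W] by fastforce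
  have not_empty: "I = {}"
    if I: "bool_join I ?w = column j X" and empty: "bool_join {} ?w = column j X" for I j
  proof (rule ccontr)
    assume "I \<noteq> {}"
    then obtain k where "k \<in> I" by blast
    have zero: "\<not> column j X $ i" for i by (simp flip: empty)
    have k: "\<not> W $ i $ k" for i
      using zero[of i] \<open>k \<in> I\<close> unfolding I[symmetric] by (auto simp: column_def)
    \<comment> \<open>Two zero columns would give two distinct singletons with join 0, against
      freeness at \<open>column j X\<close>, which is zero.\<close>
    have "l = k" if l: "\<forall>i. \<not> W $ i $ l" for l
    proof -
      have "bool_join {l} ?w = column j X" "bool_join {k} ?w = column j X"
        using l k zero by (auto simp: vec_eq_iff column_def)
      then have "{l} = {k}" using bool_freeD[OF free[of j]] by blast
      then show ?thesis by simp
    qed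
    with k have "\<exists>!k. \<forall>i. \<not> W $ i $ k" by blast
    \<comment> \<open>\<open>W\<close> has exactly one zero column, so \<open>nondegenerate\<close>
      excludes \<open>X = 0\<close>. Freeness at a non-zero column of \<open>X\<close> then forbids
      the zero column \<open>k\<close>.\<close>
    then obtain i j' where "column j' X $ i"
      using nondegenerate by (auto simp: column_def)
    then have "\<exists>i. ?w k $ i"
      using no_zero_vector_if_free[OF free] ex by blast
    then show False using k by (simp add: column_def)
  qed
  have unique: "A = B"
    if A: "bool_join A ?w = column j X" and B: "bool_join B ?w = column j X" for A B j
  proof (cases "A = {} \<or> B = {}")
    case True
    then show ?thesis using A B not_empty by metis
  next
    case False
    then show ?thesis using bool_freeD[OF free A B] by simp
  qed
  show "\<exists>!H :: bool ^ 'm ^ 'r. X = W \<otimes>\<^sub>B H"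
    unfolding ex1_factor_iff
  proof
    fix j
    show "\<exists>!I. bool_join I ?w = column j X"
      using ex[of j] unique by (rule ex_ex1I)
  qed
qed

end
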